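(* For every integer $n\ge 1$, the number of domino tilings of the Aztec diamond $AD(n)$ that are invariant under the reflection $t$ equals \[\|C_n\|_{l^1}=\sum_{(\epsilon_1,\ldots,\epsilon_{2n})\in\{0,1\}^{2n}} C_n(\epsilon_1,\ldots,\epsilon_{2n}).\]
   Context: The Aztec diamond $AD(n)$ is the union of all unit lattice squares $[i,i+1]\times[j,j+1]$ ($i,j\in\mathbb{Z}$) contained in the region $|x|+|y|\le n+1$. A domino tiling is a covering of $AD(n)$ by $1\times 2$ or $2\times1$ dominoes without gaps or overlaps. Let $t$ be the reflection across the line $x=0$ (the vertical diagonal of the diamond); a tiling is $t$-invariant if $t$ maps it to itself. For $m\ge1$, $\{0,1\}^m$ is the set of binary sequences of length $m$ and $\mathbb{Z}\langle\{0,1\}^m\rangle$ the free abelian group with basis $\{0,1\}^m$. Maps defined on basis elements are extended $\mathbb{Z}$-linearly, and a function $\{0,1\}^m\to\mathbb{Z}_{\ge0}$ is extended to the unique homomorphism $\mathbb{Z}\langle\{0,1\}^m\rangle\to\mathbb{Z}$ (sending $0$ to $0$). (i) $R_m(\epsilon_1,\ldots,\epsilon_m)=(1-\epsilon_1,\ldots,1-\epsilon_m)$. (ii) For $m\ge2$ and $1\le i\le m-1$, $E_m^i$ is the endomorphism of $\mathbb{Z}\langle\{0,1\}^m\rangle$ with $E_m^i(\epsilon)=\epsilon+\epsilon'$ if $(\epsilon_i,\epsilon_{i+1})=(0,0)$, where $\epsilon'$ is $\epsilon$ with entries $i,i+1$ replaced by $1,1$, and $E_m^i(\epsilon)=\epsilon$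 otherwise. Set $E_m=E_m^{m-1}\circ\cdots\circ E_m^{1}$. (iii) For $m\ge4$, $K_m:\mathbb{Z}\langle\{0,1\}^m\rangle\to\mathbb{Z}\langle\{0,1\}^{m-2}\rangle$ is given on basis elements $\epsilon=(\epsilon_1,\ldots,\epsilon_m)$ by: $K_m(\epsilon)=0$ if $(\epsilon_1,\epsilon_2)=(0,1)$ or $(\epsilon_{m-1},\epsilon_m)=(1,0)$; otherwise $K_m(\epsilon)=(a,\epsilon_3,\ldots,\epsilon_{m-2},b)$ where $a=0$ if $(\epsilon_1,\epsilon_2)=(1,0)$ and $a=1$ if $(\epsilon_1,\epsilon_2)\in\{(0,0),(1,1)\}$, and $b=0$ if $(\epsilon_{m-1},\epsilon_m)=(0,1)$ and $b=1$ if $(\epsilon_{m-1},\epsilon_m)\in\{(0,0),(1,1)\}$. (iv) $C_1:\{0,1\}^2\to\mathbb{Z}_{\ge0}$ is $C_1(0,0)=C_1(1,1)=1$, $C_1(0,1)=C_1(1,0)=0$, and for $n\ge2$, $C_n:\{0,1\}^{2n}\to\mathbb{Z}_{\ge0}$ is $C_n=C_{n-1}\circ R_{2n-2}\circ E_{2n-2}\circ K_{2n}$. *)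

theory Defs
  imports
    "HOL-Analysis.Analysis"
    "HOL-Library.Poly_Mapping"
    "HOL-Library.Z2"
begin

section \<open>Domino tilings of the Aztec diamond\<close>

definition unit_square :: "int \<Rightarrow> int \<Rightarrow> (real \<times> real) set" where
  "unit_square i j = {of_int i .. of_int i + 1} \<times> {of_int j .. of_int j + 1}"

definition aztec_diamond :: "nat \<Rightarrow> (real \<times> real) set" where
  "aztec_diamond n =
     \<Union> {unit_square i j | i j.
         unit_square i j \<subseteq> {(x, y). \<bar>x\<bar> + \<bar>y\<bar> \<le> real n + 1}}"

definition domino :: "(real \<times> real) set \<Rightarrow> bool" where
  "domino D \<longleftrightarrow>
     (\<exists>i j. D = unit_square i j \<union> unit_square (i + 1) j
          \<or> D = unit_square i j \<union> unit_square i (j + 1))"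

text \<open>Dominoes are closed, so two dominoes of a tiling may share boundary points;
  not overlapping means having disjoint interiors.\<close>

definition domino_tiling :: "(real \<times> real) set set \<Rightarrow> (real \<times> real) set \<Rightarrow> bool" where
  "domino_tiling T S \<longleftrightarrow>
     (\<forall>D\<in>T. domino D) \<and> \<Union>T = S \<and>
     (\<forall>D\<in>T. \<forall>D'\<in>T. D \<noteq> D' \<longrightarrow> interior D \<inter> interior D' = {})"

definition t_refl :: "real \<times> real \<Rightarrow> real \<times> real" where
  "t_refl = (\<lambda>(x, y). (- x, y))"

definition t_invariant :: "(real \<times> real) set set \<Rightarrow> bool" where
  "t_invariant T \<longleftrightarrow> (\<lambda>D. t_refl ` D) ` T = T"


section \<open>Operators on free abelian groups over binary sequences\<close>

text \<open>
  Binary sequences are lists over the two-element type \<^typ>\<open>bit\<close>, so the entry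
  $\epsilon_i$ is \<open>\<epsilon> ! (i - 1)\<close>.  Elements of the free abelian group on the sequences of
  length $m$ are the finitely supported functions \<^typ>\<open>bit list \<Rightarrow>\<^sub>0 int\<close> supported on
  \<open>binseq m\<close>; the operators below are only meaningful on these.
\<close>

definition binseq :: "nat \<Rightarrow> bit list set" where
  "binseq m = {\<epsilon>. length \<epsilon> = m}"

definition hom_extend :: "('a \<Rightarrow> int) \<Rightarrow> ('a \<Rightarrow>\<^sub>0 int) \<Rightarrow> int" where
  "hom_extend f x = (\<Sum>b\<in>Poly_Mapping.keys x. Poly_Mapping.lookup x b * f b)"

definition R_op :: "(bit list \<Rightarrow>\<^sub>0 int) \<Rightarrow> (bit list \<Rightarrow>\<^sub>0 int)" where
  "R_op = frag_extend (\<lambda>\<epsilon>. frag_of (map (\<lambda>e. 1 - e) \<epsilon>))"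

definition E_step :: "nat \<Rightarrow> (bit list \<Rightarrow>\<^sub>0 int) \<Rightarrow> (bit list \<Rightarrow>\<^sub>0 int)" where
  "E_step i = frag_extend (\<lambda>\<epsilon>.
     if (\<epsilon> ! (i - 1), \<epsilon> ! i) = (0, 0)
     then frag_of \<epsilon> + frag_of (\<epsilon>[i - 1 := 1, i := 1])
     else frag_of \<epsilon>)"

text \<open>\<^const>\<open>fold\<close> applies \<open>E_step 1\<close> first and \<open>E_step (m - 1)\<close> last.\<close>

definition E_op :: "nat \<Rightarrow> (bit list \<Rightarrow>\<^sub>0 int) \<Rightarrow> (bit list \<Rightarrow>\<^sub>0 int)" where
  "E_op m = fold E_step [1..<m]"

text \<open>Once the two vanishing cases are excluded, the remaining pairs in the definition
  of $a$ and of $b$ are exactly $(0,0)$ and $(1,1)$.\<close>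

definition K_op :: "nat \<Rightarrow> (bit list \<Rightarrow>\<^sub>0 int) \<Rightarrow> (bit list \<Rightarrow>\<^sub>0 int)" where
  "K_op m = frag_extend (\<lambda>\<epsilon>.
     let l = (\<epsilon> ! 0, \<epsilon> ! 1); r = (\<epsilon> ! (m - 2), \<epsilon> ! (m - 1)) in
     if l = (0, 1) \<or> r = (1, 0) then 0
     else frag_of ([if l = (1, 0) then 0 else 1]
                   @ take (m - 4) (drop 2 \<epsilon>)
                   @ [if r = (0, 1) then 0 else 1]))"

text \<open>The values at \<open>n = 0\<close> are irrelevant.\<close>

fun C_fun :: "nat \<Rightarrow> bit list \<Rightarrow> int" where
  "C_fun n =
     (if n \<le> 1 then (\<lambda>\<epsilon>. if \<epsilon> = [0, 0] \<or> \<epsilon> = [1, 1] then 1 else 0)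
      else hom_extend (C_fun (n - 1)) \<circ> R_op \<circ> E_op (2 * n - 2) \<circ> K_op (2 * n) \<circ> frag_of)"

declare C_fun.simps [simp del]

definition l1_norm :: "nat \<Rightarrow> (bit list \<Rightarrow> int) \<Rightarrow> int" where
  "l1_norm m f = (\<Sum>\<epsilon>\<in>binseq m. \<bar>f \<epsilon>\<bar>)"

end

theory Submission
  imports Defs
begin

text \<open>A reflection-invariant tiling is determined by its dominoes in the right half: the cells of
  column \<open>0\<close> that they miss are covered by dominoes crossing the axis. So one counts tilings of
  right half diamonds whose first column has some cells removed, the removed cells being marked
  \<open>1\<close> in the sequence \<open>\<epsilon>\<close>. Scanning such a column, \<open>K_op\<close> resolves its two extreme cells, which have
  no right neighbour; the \<open>E_step\<close>s choose the vertical dominoes among the others; the cells still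
  free are then covered by horizontal dominoes, so they become the removed cells of the next
  column, which is the complementation \<open>R_op\<close>.\<close>

section \<open>Exact covers by prescribed blocks\<close>

text \<open>The admissible blocks are a parameter, so that single dominoes can be forbidden while
  the region stays the same.\<close>

definition tilings :: "'a set set \<Rightarrow> 'a set \<Rightarrow> 'a set set set" where
  "tilings A R = {P. P \<subseteq> A \<and> disjoint P \<and> \<Union>P = R}"

definition num_tilings :: "'a set set \<Rightarrow> 'a set \<Rightarrow> int" where
  "num_tilings A R = int (card (tilings A R))"

lemma finite_tilings: "finite R \<Longrightarrow> finite (tilings A R)"
  by (rule finite_subset[of _ "Pow (Pow R)"]) (auto simp: tilings_def)

lemma tilings_cong:
  assumes "\<And>d. d \<subseteq> R \<Longrightarrow> d \<in> A \<longleftrightarrow> d \<in> B"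
  shows "tilings A R = tilings B R"
  using assms unfolding tilings_def by blast

lemma Union_Diff_disjoint:
  assumes "disjoint P" "F \<subseteq> P"
  shows "\<Union>(P - F) = \<Union>P - \<Union>F"
proof (intro equalityI subsetI)
  fix x assume "x \<in> \<Union>(P - F)"
  then obtain d where d: "d \<in> P" "d \<notin> F" "x \<in> d" by auto
  have "x \<notin> e" if "e \<in> F" for e
    using disjointD[OF assms(1) d(1), of e] that d assms(2) by auto
  then show "x \<in> \<Union>P - \<Union>F" using d by auto
qed auto

text \<open>Removing and adding \<open>F\<close> are inverse to each other. An empty block in
  \<open>F\<close> would break this, since a tiling of the rest could contain it too.\<close>

lemma card_tilings_containing:
  assumes "F \<subseteq> A" "disjoint F" "\<Union>F \<subseteq> R" "{} \<notin> F"
  shows "card {P \<in> tilings A R. F \<subseteq> P} = card (tilings A (R - \<Union>F))"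
proof (rule bij_betw_same_card, rule bij_betw_byWitness[where f' = "\<lambda>P. P \<union> F"])
  have "P \<inter> F = {}" if "P \<in> tilings A (R - \<Union>F)" for P
  proof -
    have "\<Union>P \<inter> \<Union>F = {}" using that by (auto simp: tilings_def)
    then have "d = {}" if "d \<in> P" "d \<in> F" for d using that by auto
    then show ?thesis using assms(4) by auto
  qed
  then show "\<forall>P\<in>tilings A (R - \<Union>F). P \<union> F - F = P" by blast
  show "(\<lambda>P. P \<union> F) ` tilings A (R - \<Union>F) \<subseteq> {P \<in> tilings A R. F \<subseteq> P}"
  proof
    fix Q assume "Q \<in> (\<lambda>P. P \<union> F) ` tilings A (R - \<Union>F)"
    then obtain P where P: "Q = P \<union> F" "P \<subseteq> A" "disjoint P" "\<Union>P = R - \<Union>F"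
      by (auto simp: tilings_def)
    have "disjoint Q" unfolding P(1) using P assms(2) by (intro disjoint_union) auto
    moreover have "\<Union>Q = R" using P assms(3) by auto
    ultimately show "Q \<in> {P \<in> tilings A R. F \<subseteq> P}" using P assms(1) by (auto simp: tilings_def)
  qed
  show "(\<lambda>P. P - F) ` {P \<in> tilings A R. F \<subseteq> P} \<subseteq> tilings A (R - \<Union>F)"
  proof
    fix Q assume "Q \<in> (\<lambda>P. P - F) ` {P \<in> tilings A R. F \<subseteq> P}"
    then obtain P where P: "Q = P - F" "P \<subseteq> A" "disjoint P" "\<Union>P = R" "F \<subseteq> P"
      by (auto simp: tilings_def)
    then have "disjoint Q" "\<Union>Q = R - \<Union>F"
      using Union_Diff_disjoint[of P F] by (auto intro: pairwise_subset)
    then show "Q \<in> tilings A (R - \<Union>F)" using P by (auto simp: tilings_def)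
  qed
qed auto

text \<open>Deletion and contraction of one block: a tiling avoids \<open>d\<close>, or it contains
  \<open>d\<close> and the rest tiles \<open>R - d\<close>, where the nonempty \<open>d\<close>
  cannot occur again. Each \<open>E_step\<close> performs this recursion.\<close>

lemma num_tilings_delete:
  assumes "finite R" "d \<in> A" "d \<noteq> {}"
  shows "num_tilings A R
    = num_tilings (A - {d}) R + (if d \<subseteq> R then num_tilings (A - {d}) (R - d) else 0)"
proof -
  let ?S = "{P \<in> tilings A R. {d} \<subseteq> P}"
  have split: "tilings A R = tilings (A - {d}) R \<union> ?S" "tilings (A - {d}) R \<inter> ?S = {}"
    by (auto simp: tilings_def)
  have "card ?S = (if d \<subseteq> R then card (tilings (A - {d}) (R - d)) else 0)"
  proof (cases "d \<subseteq> R")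
    case True
    then have "card ?S = card (tilings A (R - d))"
      using card_tilings_containing[of "{d}" A R] assms by auto
    also have "tilings A (R - d) = tilings (A - {d}) (R - d)"
      using assms by (intro tilings_cong) auto
    finally show ?thesis using True by simp
  next
    case False
    then have "?S = {}" by (auto simp: tilings_def)
    then show ?thesis using False by (simp only: card.empty if_False)
  qed
  moreover have "card (tilings A R) = card (tilings (A - {d}) R) + card ?S"
    by (subst split(1), rule card_Un_disjoint)
      (use assms(1) split(2) in \<open>simp_all add: finite_tilings\<close>)
  ultimately show ?thesis by (simp add: num_tilings_def)
qed

section \<open>Uncoverable cells and forced blocks\<close>

lemma num_tilings_uncoverable:
  assumes "c \<in> R" "\<And>d. d \<in> A \<Longrightarrow> c \<in> d \<Longrightarrow> \<not> d \<subseteq> R"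
  shows "num_tilings A R = 0"
proof -
  have "P \<notin> tilings A R" for P
  proof
    assume "P \<in> tilings A R"
    then have P: "P \<subseteq> A" "\<Union>P = R" by (auto simp: tilings_def)
    then obtain d where "d \<in> P" "c \<in> d" using assms(1) by blast
    then show False using P assms(2)[of d] by blast
  qed
  then have "tilings A R = {}" by blast
  then show ?thesis by (simp add: num_tilings_def)
qed

text \<open>Without \<open>d\<close> nothing could cover \<open>c\<close>, so only the contraction
  term of \<open>num_tilings_delete\<close> survives.\<close>

lemma num_tilings_forced:
  assumes "finite R" "c \<in> R" "c \<in> d" "d \<in> A"
    and "\<And>d'. d' \<in> A \<Longrightarrow> c \<in> d' \<Longrightarrow> d' \<subseteq> R \<Longrightarrow> d' = d"
  shows "num_tilings A R = (if d \<subseteq> R then num_tilings A (R - d) else 0)"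
proof -
  have "num_tilings (A - {d}) R = 0"
    using assms(2,5) by (intro num_tilings_uncoverable[of c]) auto
  moreover have "tilings (A - {d}) (R - d) = tilings A (R - d)"
    using assms(3) by (intro tilings_cong) auto
  moreover have "d \<noteq> {}" using assms(3) by auto
  ultimately show ?thesis
    using num_tilings_delete[of R d A] assms(1,4) by (auto simp: num_tilings_def)
qed

lemma num_tilings_empty:
  assumes "{} \<notin> A"
  shows "num_tilings A {} = 1"
proof -
  have "tilings A {} = {{}}" using assms by (auto simp: tilings_def)
  then show ?thesis by (simp add: num_tilings_def)
qed

text \<open>Each block of \<open>F\<close> owns a cell that no other block inside \<open>R\<close>
  can cover, so every tiling contains all of \<open>F\<close>.\<close>

lemma num_tilings_forced_family:
  assumes "F \<subseteq> A" "disjoint F" "\<Union>F \<subseteq> R"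
    and forced: "\<And>d. d \<in> F \<Longrightarrow> \<exists>c\<in>d. \<forall>d'\<in>A. c \<in> d' \<longrightarrow> d' \<subseteq> R \<longrightarrow> d' = d"
  shows "num_tilings A R = num_tilings A (R - \<Union>F)"
proof -
  have "F \<subseteq> P" if "P \<in> tilings A R" for P
  proof
    have P: "P \<subseteq> A" "\<Union>P = R" using that by (auto simp: tilings_def)
    fix d assume d: "d \<in> F"
    then obtain c where c: "c \<in> d" "\<forall>d'\<in>A. c \<in> d' \<longrightarrow> d' \<subseteq> R \<longrightarrow> d' = d"
      using forced by blast
    then have "c \<in> \<Union>P" using P(2) d assms(3) by auto
    then obtain d' where d': "d' \<in> P" "c \<in> d'" by blast
    then have "d' \<in> A" "d' \<subseteq> R" using P by auto
    then show "d \<in> P" using c(2) d' by auto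
  qed
  then have "{P \<in> tilings A R. F \<subseteq> P} = tilings A R" by auto
  moreover have "{} \<notin> F" using forced by auto
  ultimately show ?thesis
    using card_tilings_containing[OF assms(1-3)] by (simp add: num_tilings_def)
qed

section \<open>Dominoes and half diamonds\<close>

text \<open>A cell \<open>(i, j)\<close> stands for the unit square with lower left corner
  \<open>(i, j)\<close>.\<close>

definition hdom :: "int \<Rightarrow> int \<Rightarrow> (int \<times> int) set" where
  "hdom i j = {(i, j), (i + 1, j)}"

definition vdom :: "int \<Rightarrow> int \<Rightarrow> (int \<times> int) set" where
  "vdom i j = {(i, j), (i, j + 1)}"

definition dominoes :: "(int \<times> int) set set" where
  "dominoes = {d. \<exists>i j. d = hdom i j \<or> d = vdom i j}"

lemma dominoes_simps [simp]:
  "hdom i j \<in> dominoes" "vdom i j \<in> dominoes" "{} \<notin> dominoes" "hdom i j \<noteq> vdom i' j'"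
  "vdom i' j' \<noteq> hdom i j" "vdom i j = vdom i' j' \<longleftrightarrow> i = i' \<and> j = j'"
  "hdom i j = hdom i' j' \<longleftrightarrow> i = i' \<and> j = j'" "hdom i j \<noteq> {}" "vdom i j \<noteq> {}"
  by (auto simp: dominoes_def hdom_def vdom_def doubleton_eq_iff)

lemma mem_vdom: "(a, b) \<in> vdom i j \<longleftrightarrow> a = i \<and> (b = j \<or> b = j + 1)"
  by (auto simp: vdom_def)

lemma dominoes_through:
  assumes "d \<in> dominoes" "(i, j) \<in> d"
  obtains "d = hdom i j" | "d = hdom (i - 1) j" | "d = vdom i j" | "d = vdom i (j - 1)"
  using assms by (auto simp: dominoes_def hdom_def vdom_def)

text \<open>For \<open>k \<ge> 0\<close> the first part consists of the columns of the diamond to the right of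
  column \<open>k\<close>.\<close>

definition region :: "nat \<Rightarrow> int \<Rightarrow> int set \<Rightarrow> (int \<times> int) set" where
  "region n k X = {(i, j). k < i \<and> i - int n \<le> j \<and> j < int n - i} \<union> {k} \<times> X"

lemma mem_region:
  "(i, j) \<in> region n k X \<longleftrightarrow> k < i \<and> i - int n \<le> j \<and> j < int n - i \<or> i = k \<and> j \<in> X"
  by (auto simp: region_def)

lemma finite_region: "finite X \<Longrightarrow> finite (region n k X)"
  unfolding region_def
  by (rule finite_UnI, rule finite_subset[of _ "{k..int n} \<times> {k - int n..int n - k}"]) auto

section \<open>Forced dominoes in the first column of a region\<close>

lemma hdom_subset: "hdom i j \<subseteq> R \<longleftrightarrow> (i, j) \<in> R \<and> (i + 1, j) \<in> R"
  by (auto simp: hdom_def)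

lemma vdom_subset: "vdom i j \<subseteq> R \<longleftrightarrow> (i, j) \<in> R \<and> (i, j + 1) \<in> R"
  by (auto simp: vdom_def)

lemma region_minus_vdom: "region n k X - vdom k j = region n k (X - {j, j + 1})"
  by (auto simp: region_def vdom_def)

text \<open>The lowest cell of column \<open>k\<close> has no neighbour in the region to the left,
  below or to the right, since column \<open>k + 1\<close> starts one unit higher. Only the vertical
  domino upwards remains.\<close>

lemma num_tilings_bottom:
  assumes "finite X" "X \<subseteq> {k - int n..<int n - k}" "k - int n \<in> X"
  shows "num_tilings dominoes (region n k X) = (if k - int n + 1 \<in> X
    then num_tilings dominoes (region n k (X - {k - int n, k - int n + 1})) else 0)"
proof -
  have "num_tilings dominoes (region n k X) = (if vdom k (k - int n) \<subseteq> region n k X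
      then num_tilings dominoes (region n k X - vdom k (k - int n)) else 0)"
  proof (rule num_tilings_forced)
    show "(k, k - int n) \<in> region n k X" using assms by (simp add: mem_region)
    fix d assume d: "d \<in> dominoes" "(k, k - int n) \<in> d" "d \<subseteq> region n k X"
    show "d = vdom k (k - int n)"
      by (rule dominoes_through[OF d(1,2)])
        (use d(3) assms(2) in \<open>auto simp: hdom_subset vdom_subset mem_region\<close>)
  qed (use assms in \<open>simp_all add: finite_region mem_vdom\<close>)
  then show ?thesis
    using assms by (simp add: region_minus_vdom) (auto simp: vdom_subset mem_region)
qed

text \<open>The same at the upper end, where column \<open>k + 1\<close> stops one unit lower and
  the forced domino points down.\<close>

lemma num_tilings_top:
  assumes "finite X" "X \<subseteq> {k - int n..<int n - k}" "int n - k - 1 \<in> X"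
  shows "num_tilings dominoes (region n k X) = (if int n - k - 2 \<in> X
    then num_tilings dominoes (region n k (X - {int n - k - 2, int n - k - 1})) else 0)"
proof -
  have "num_tilings dominoes (region n k X) = (if vdom k (int n - k - 2) \<subseteq> region n k X
      then num_tilings dominoes (region n k X - vdom k (int n - k - 2)) else 0)"
  proof (rule num_tilings_forced)
    show "(k, int n - k - 1) \<in> region n k X" using assms by (simp add: mem_region)
    fix d assume d: "d \<in> dominoes" "(k, int n - k - 1) \<in> d" "d \<subseteq> region n k X"
    show "d = vdom k (int n - k - 2)"
      by (rule dominoes_through[OF d(1,2)])
        (use d(3) assms(2) in \<open>auto simp: hdom_subset vdom_subset mem_region\<close>)
  qed (use assms in \<open>simp_all add: finite_region mem_vdom\<close>)
  then show ?thesis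
    using assms by (simp add: region_minus_vdom) (auto simp: vdom_subset mem_region)
qed

text \<open>\<open>X\<close> avoids both extreme cells, so each of its cells has a right neighbour.
  As \<open>A\<close> has no vertical domino inside \<open>X\<close>, all the horizontal ones are
  forced, and they leave the complement of \<open>X\<close> in column \<open>k + 1\<close>.\<close>

lemma num_tilings_horizontal:
  assumes X: "X \<subseteq> {k + 1 - int n..<int n - k - 1}"
    and A: "A \<subseteq> dominoes" "\<And>j. vdom k j \<in> A \<Longrightarrow> \<not> (j \<in> X \<and> j + 1 \<in> X)"
      "dominoes - range (vdom k) \<subseteq> A"
  shows "num_tilings A (region n k X)
    = num_tilings dominoes (region n (k + 1) ({k + 1 - int n..<int n - k - 1} - X))"
proof -
  have "num_tilings A (region n k X) = num_tilings A (region n k X - \<Union>(hdom k ` X))"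
  proof (rule num_tilings_forced_family)
    show "hdom k ` X \<subseteq> A" using A(3) by auto
    show "disjoint (hdom k ` X)"
      by (auto simp: pairwise_def disjnt_def hdom_def)
    show "\<Union> (hdom k ` X) \<subseteq> region n k X"
      using X by (auto simp: hdom_def mem_region)
    fix d assume "d \<in> hdom k ` X"
    then obtain j where j: "j \<in> X" "d = hdom k j" by auto
    have "d' = hdom k j" if "d' \<in> A" "(k, j) \<in> d'" "d' \<subseteq> region n k X" for d'
    proof -
      have "d' \<in> dominoes" using that A(1) by auto
      \<comment> \<open>The domino to the left leaves the region; a vertical one would need two
        adjacent cells of \<open>X\<close>, which \<open>A\<close> excludes.\<close>
      then show ?thesis using that(2)
      proof (cases rule: dominoes_through)
        case 2
        then show ?thesis using that by (auto simp: hdom_subset mem_region)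
      next
        case 3
        then show ?thesis using that A(2)[of j] by (auto simp: vdom_subset mem_region)
      next
        case 4
        then show ?thesis using that A(2)[of "j - 1"] by (auto simp: vdom_subset mem_region)
      qed
    qed
    then show "\<exists>c\<in>d. \<forall>d'\<in>A. c \<in> d' \<longrightarrow> d' \<subseteq> region n k X \<longrightarrow> d' = d"
      using j by (auto simp: hdom_def)
  qed
  also have "region n k X - \<Union>(hdom k ` X)
      = region n (k + 1) ({k + 1 - int n..<int n - k - 1} - X)"
  proof -
    have "\<Union>(hdom k ` X) = {k, k + 1} \<times> X" by (auto simp: hdom_def)
    then show ?thesis using X by (auto simp: mem_region)
  qed
  also have "num_tilings A \<dots> = num_tilings dominoes \<dots>" (is "num_tilings A ?R = _")
  proof -
    \<comment> \<open>\<open>A\<close> lacks at most vertical dominoes of column \<open>k\<close>,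
      and the new region has no cell there.\<close>
    have "d \<in> A \<longleftrightarrow> d \<in> dominoes" if "d \<subseteq> ?R" for d
    proof -
      have "d \<notin> range (vdom k)" using that by (auto simp: vdom_subset mem_region)
      then show ?thesis using A(1,3) by auto
    qed
    then have "tilings A ?R = tilings dominoes ?R" by (rule tilings_cong)
    then show ?thesis by (simp add: num_tilings_def)
  qed
  finally show ?thesis .
qed

section \<open>Column states and the operators\<close>

text \<open>The entry \<open>0\<close> marks a free cell, the entry \<open>1\<close> an already covered one; \<open>b\<close> is the
  height of the first cell.\<close>

fun free :: "int \<Rightarrow> bit list \<Rightarrow> int set" where
  "free b [] = {}"
| "free b (e # es) = (if e = 0 then {b} else {}) \<union> free (b + 1) es"

lemma free_append: "free b (xs @ ys) = free b xs \<union> free (b + int (length xs)) ys"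
  by (induction xs arbitrary: b) (auto simp: add_ac)

lemma free_subset: "free b \<epsilon> \<subseteq> {b..<b + int (length \<epsilon>)}"
proof (induction \<epsilon> arbitrary: b)
  case (Cons e \<epsilon>)
  from Cons[of "b + 1"] show ?case by (auto simp: subset_iff)
qed simp

lemma finite_free: "finite (free b \<epsilon>)"
  using free_subset by (rule finite_subset) simp

lemma free_conv_nth: "free b \<epsilon> = {b + int l | l. l < length \<epsilon> \<and> \<epsilon> ! l = 0}"
proof (induction \<epsilon> arbitrary: b)
  case (Cons e \<epsilon>)
  show ?case
  proof (intro set_eqI iffI)
    fix x assume "x \<in> free b (e # \<epsilon>)"
    then consider "e = 0" "x = b" | "x \<in> free (b + 1) \<epsilon>" by (auto split: if_splits)
    then show "x \<in> {b + int l | l. l < length (e # \<epsilon>) \<and> (e # \<epsilon>) ! l = 0}"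
    proof cases
      case 1
      then show ?thesis by (auto intro!: exI[of _ 0])
    next
      case 2
      then obtain l where "x = b + 1 + int l" "l < length \<epsilon>" "\<epsilon> ! l = 0"
        unfolding Cons by auto
      then show ?thesis by (auto intro!: exI[of _ "Suc l"])
    qed
  next
    fix x assume "x \<in> {b + int l | l. l < length (e # \<epsilon>) \<and> (e # \<epsilon>) ! l = 0}"
    then obtain l where "x = b + int l" "l < length (e # \<epsilon>)" "(e # \<epsilon>) ! l = 0" by auto
    then show "x \<in> free b (e # \<epsilon>)"
      by (cases l) (auto simp: Cons)
  qed
qed simp

lemma mem_free_iff: "l < length \<epsilon> \<Longrightarrow> b + int l \<in> free b \<epsilon> \<longleftrightarrow> \<epsilon> ! l = 0"
  by (auto simp: free_conv_nth)

text \<open>With \<open>f e = 1 - e\<close> this is the effect of \<open>R_op\<close>: free and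
  covered cells change roles.\<close>

lemma free_complement:
  assumes "\<And>e. f e = 0 \<longleftrightarrow> e \<noteq> 0"
  shows "free b (map f \<epsilon>) = {b..<b + int (length \<epsilon>)} - free b \<epsilon>"
proof (induction \<epsilon> arbitrary: b)
  case (Cons e \<epsilon>)
  have "b \<notin> free (b + 1) \<epsilon>" using free_subset[of "b + 1" \<epsilon>] by auto
  then show ?case using assms[of e] by (auto simp: Cons)
qed simp

lemma free_update:
  assumes "l < length \<epsilon>"
  shows "free b (\<epsilon>[l := 1]) = free b \<epsilon> - {b + int l}"
proof (intro set_eqI iffI)
  fix x assume "x \<in> free b (\<epsilon>[l := 1])"
  then show "x \<in> free b \<epsilon> - {b + int l}"
    using assms by (auto simp: free_conv_nth nth_list_update split: if_splits)
next
  fix x assume "x \<in> free b \<epsilon> - {b + int l}"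
  then obtain l' where "x = b + int l'" "l' < length \<epsilon>" "\<epsilon> ! l' = 0" "l' \<noteq> l"
    by (auto simp: free_conv_nth)
  then show "x \<in> free b (\<epsilon>[l := 1])" by (auto simp: free_conv_nth)
qed

text \<open>Turns a sum over sets of free cells into a sum over binary sequences.\<close>

lemma bij_betw_free: "bij_betw (free b) (binseq m) (Pow {b..<b + int m})"
proof (rule bij_betwI')
  fix x y assume "x \<in> binseq m" "y \<in> binseq m"
  then have len: "length x = m" "length y = m" by (auto simp: binseq_def)
  show "free b x = free b y \<longleftrightarrow> x = y"
  proof
    assume eq: "free b x = free b y"
    show "x = y"
    proof (rule nth_equalityI)
      fix l assume "l < length x"
      then have "x ! l = 0 \<longleftrightarrow> y ! l = 0" using len eq mem_free_iff by metis
      then show "x ! l = y ! l" by (cases "x ! l"; cases "y ! l") auto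
    qed (use len in simp)
  qed simp
next
  fix x assume "x \<in> binseq m"
  then show "free b x \<in> Pow {b..<b + int m}" using free_subset by (auto simp: binseq_def)
next
  fix Y assume Y: "Y \<in> Pow {b..<b + int m}"
  define x :: "bit list" where "x = map (\<lambda>l. if b + int l \<in> Y then 0 else 1) [0..<m]"
  have "free b x = Y"
  proof (intro set_eqI iffI)
    fix z assume "z \<in> free b x"
    then show "z \<in> Y" by (auto simp: free_conv_nth x_def split: if_splits)
  next
    fix z assume z: "z \<in> Y"
    then have "b \<le> z" "z < b + int m" using Y by auto
    then have "z = b + int (nat (z - b))" "nat (z - b) < m" by auto
    then show "z \<in> free b x" using z mem_free_iff[of "nat (z - b)" x b] by (simp add: x_def)
  qed
  moreover have "x \<in> binseq m" by (simp add: binseq_def x_def)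
  ultimately show "\<exists>x\<in>binseq m. Y = free b x" by auto
qed

section \<open>Linear extension, and the operators on basis elements\<close>

lemma hom_extend_superset:
  assumes "finite S" "Poly_Mapping.keys x \<subseteq> S"
  shows "hom_extend f x = (\<Sum>b\<in>S. Poly_Mapping.lookup x b * f b)"
  unfolding hom_extend_def using assms
  by (intro sum.mono_neutral_left) (auto simp: in_keys_iff)

lemma hom_extend_0 [simp]: "hom_extend f 0 = 0"
  by (simp add: hom_extend_def)

lemma hom_extend_frag_of [simp]: "hom_extend f (frag_of b) = f b"
  by (simp add: hom_extend_def)

lemma hom_extend_add: "hom_extend f (x + y) = hom_extend f x + hom_extend f y"
proof -
  \<comment> \<open>Keys can cancel in \<open>x + y\<close>, so all three sums are taken over one
    common finite set.\<close>
  let ?S = "Poly_Mapping.keys x \<union> Poly_Mapping.keys y"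
  have "hom_extend f z = (\<Sum>b\<in>?S. Poly_Mapping.lookup z b * f b)" if "z \<in> {x, y, x + y}" for z
    using that Poly_Mapping.keys_add[of x y] by (intro hom_extend_superset) auto
  then show ?thesis by (simp add: lookup_add algebra_simps sum.distrib)
qed

lemma hom_extend_diff: "hom_extend f (x - y) = hom_extend f x - hom_extend f y"
  using hom_extend_add[of f "x - y" y] by simp

text \<open>\<open>R_op\<close> sends basis elements to basis elements, so it can be moved into the
  function being extended.\<close>

lemma hom_extend_R_op: "hom_extend f (R_op x) = hom_extend (\<lambda>\<epsilon>. f (map (\<lambda>e. 1 - e) \<epsilon>)) x"
proof (rule frag_induction[of x UNIV])
  fix a b
  assume "hom_extend f (R_op a) = hom_extend (\<lambda>\<epsilon>. f (map (\<lambda>e. 1 - e) \<epsilon>)) a"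
    "hom_extend f (R_op b) = hom_extend (\<lambda>\<epsilon>. f (map (\<lambda>e. 1 - e) \<epsilon>)) b"
  then show "hom_extend f (R_op (a - b)) = hom_extend (\<lambda>\<epsilon>. f (map (\<lambda>e. 1 - e) \<epsilon>)) (a - b)"
    by (simp add: R_op_def frag_extend_diff hom_extend_diff)
qed (simp_all add: R_op_def)

lemma fold_E_step_add: "fold E_step is (x + y) = fold E_step is x + fold E_step is y"
  by (induction "is" arbitrary: x y) (simp_all add: E_step_def frag_extend_add)

lemma E_step_frag_of:
  "E_step i (frag_of \<epsilon>) = (if \<epsilon> ! (i - 1) = 0 \<and> \<epsilon> ! i = 0
    then frag_of \<epsilon> + frag_of (\<epsilon>[i - 1 := 1, i := 1]) else frag_of \<epsilon>)"
  by (simp add: E_step_def)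

lemma fold_E_step_0: "fold E_step is 0 = 0"
  by (induction "is") (simp_all add: E_step_def)

lemma C_fun_Suc:
  "M \<ge> 1 \<Longrightarrow> C_fun (Suc M) \<epsilon>
    = hom_extend (C_fun M) (R_op (E_op (2 * M) (K_op (2 * M + 2) (frag_of \<epsilon>))))"
  by (subst C_fun.simps) simp

lemma K_op_frag_of:
  "K_op (length \<delta> + 4) (frag_of (e1 # e2 # \<delta> @ [e3, e4])) =
    (if (e1, e2) = (0, 1) \<or> (e3, e4) = (1, 0) then 0
     else frag_of ((if (e1, e2) = (1, 0) then 0 else 1) # \<delta>
       @ [if (e3, e4) = (0, 1) then 0 else 1]))"
  by (simp add: K_op_def Let_def nth_append)

text \<open>\<open>E_step i\<close> decides whether the vertical domino on the entries \<open>i\<close>, \<open>i + 1\<close> is used, so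
  before it the dominoes on earlier pairs are forbidden.\<close>

definition undecided :: "int \<Rightarrow> int \<Rightarrow> nat \<Rightarrow> (int \<times> int) set set" where
  "undecided k b i = dominoes - {vdom k (b + int l) | l. Suc l < i}"

text \<open>Downward induction on \<open>i\<close>. \<open>E_step i\<close> is the deletion
  recursion for the domino on entries \<open>i\<close> and \<open>i + 1\<close>: the unchanged
  sequence forbids it, the changed one uses it and marks both of its cells as covered.\<close>

lemma hom_extend_E_steps:
  assumes g: "\<And>\<delta>. length \<delta> = m \<Longrightarrow> g \<delta> = num_tilings (undecided k b m) (region n k (free b \<delta>))"
    and "1 \<le> i" "i \<le> m" "length \<epsilon> = m"
  shows "hom_extend g (fold E_step [i..<m] (frag_of \<epsilon>))
    = num_tilings (undecided k b i) (region n k (free b \<epsilon>))"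
  using assms(3,2,4)
proof (induction i arbitrary: \<epsilon> rule: inc_induct)
  case base
  then show ?case by (simp add: g)
next
  case (step i)
  let ?d = "vdom k (b + int (i - 1))" and ?\<epsilon> = "\<epsilon>[i - 1 := 1, i := 1]"
  have IH: "hom_extend g (fold E_step [Suc i..<m] (frag_of \<delta>))
    = num_tilings (undecided k b (Suc i)) (region n k (free b \<delta>))" if "length \<delta> = m" for \<delta>
    using step that by auto
  have split: "[i..<m] = i # [Suc i..<m]" using step by (simp add: upt_conv_Cons)
  \<comment> \<open>Entries are counted from one in \<open>E_step\<close> but from zero in
    \<open>undecided\<close>: the domino decided now has \<open>l = i - 1\<close>, the new case of
    \<open>Suc l < Suc i\<close>.\<close>
  have A: "undecided k b i - {?d} = undecided k b (Suc i)"
  proof -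
    obtain i' where "i = Suc i'" using step.prems(1) by (cases i) auto
    then show ?thesis by (auto simp: undecided_def less_Suc_eq)
  qed
  have "b + int (i - 1) + 1 = b + int i" using step.prems(1) by simp
  then have sub: "?d \<subseteq> region n k (free b \<epsilon>) \<longleftrightarrow> \<epsilon> ! (i - 1) = 0 \<and> \<epsilon> ! i = 0"
    using step mem_free_iff[of "i - 1" \<epsilon> b] mem_free_iff[of i \<epsilon> b]
    by (auto simp: vdom_subset mem_region)
  have "free b ?\<epsilon> = free b \<epsilon> - {b + int (i - 1), b + int i}"
    using step by (auto simp: free_update)
  then have minus: "region n k (free b \<epsilon>) - ?d = region n k (free b ?\<epsilon>)"
    using step.prems(1) by (simp add: region_minus_vdom)
  have "num_tilings (undecided k b i) (region n k (free b \<epsilon>))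
      = num_tilings (undecided k b (Suc i)) (region n k (free b \<epsilon>))
        + (if \<epsilon> ! (i - 1) = 0 \<and> \<epsilon> ! i = 0
           then num_tilings (undecided k b (Suc i)) (region n k (free b ?\<epsilon>)) else 0)"
    using num_tilings_delete[of "region n k (free b \<epsilon>)" ?d "undecided k b i"]
    unfolding A sub minus
    by (auto simp: finite_region finite_free undecided_def)
  then show ?case
    using step.prems(2) unfolding split
    by (simp add: E_step_frag_of fold_E_step_add hom_extend_add IH)
qed

text \<open>Column \<open>k\<close> has heights \<open>- M - 1\<close> to \<open>M\<close>; the
  sequence describes it without its two extreme cells. After the last step no vertical domino on two
  free cells is allowed, so \<open>num_tilings_horizontal\<close> passes to column
  \<open>k + 1\<close>.\<close>

lemma hom_extend_E_op:
  assumes "length \<epsilon> = 2 * M" "M \<ge> 1" "int n = k + int M + 1"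
    and g: "\<And>\<delta>. length \<delta> = 2 * M \<Longrightarrow>
      g \<delta> = num_tilings dominoes (region n (k + 1) (free (- int M) (map (\<lambda>e. 1 - e) \<delta>)))"
  shows "hom_extend g (E_op (2 * M) (frag_of \<epsilon>))
    = num_tilings dominoes (region n k (free (- int M) \<epsilon>))"
proof -
  have "num_tilings (undecided k (- int M) (2 * M)) (region n k (free (- int M) \<delta>)) = g \<delta>"
    if "length \<delta> = 2 * M" for \<delta>
  proof -
    have X: "free (- int M) \<delta> \<subseteq> {- int M..<int M}"
      using free_subset[of "- int M" \<delta>] that by simp
    have range: "{k + 1 - int n..<int n - k - 1} = {- int M..<int M}" using assms(3) by auto
    have "num_tilings (undecided k (- int M) (2 * M)) (region n k (free (- int M) \<delta>))
      = num_tilings dominoes (region n (k + 1) ({k + 1 - int n..<int n - k - 1} - free (- int M) \<delta>))"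
    proof (rule num_tilings_horizontal)
      fix j assume "vdom k j \<in> undecided k (- int M) (2 * M)"
      \<comment> \<open>Two adjacent free cells have index \<open>l = j + M\<close> with
        \<open>Suc l < 2 * M\<close>, so their vertical domino is among the forbidden ones.\<close>
      moreover have "j = - int M + int (nat (j + int M))" "Suc (nat (j + int M)) < 2 * M"
        if "j \<in> free (- int M) \<delta>" "j + 1 \<in> free (- int M) \<delta>"
      proof -
        have "- int M \<le> j" "j + 1 < int M" using that X by auto
        then show "j = - int M + int (nat (j + int M))" "Suc (nat (j + int M)) < 2 * M" by auto
      qed
      ultimately show "\<not> (j \<in> free (- int M) \<delta> \<and> j + 1 \<in> free (- int M) \<delta>)"
        unfolding undecided_def by auto
    qed (use X range in \<open>auto simp: undecided_def\<close>)
    moreover have "free (- int M) (map (\<lambda>e. 1 - e) \<delta>) = {- int M..<int M} - free (- int M) \<delta>"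
      using that by (subst free_complement) (auto simp: bit_not_zero_iff)
    ultimately show ?thesis unfolding g[OF that] range by (simp only:)
  qed
  then have "hom_extend g (fold E_step [1..<2 * M] (frag_of \<epsilon>))
    = num_tilings (undecided k (- int M) 1) (region n k (free (- int M) \<epsilon>))"
    using assms by (intro hom_extend_E_steps) auto
  \<comment> \<open>At \<open>i = 1\<close> nothing is forbidden yet, so \<open>undecided\<close> is
    all of \<open>dominoes\<close>.\<close>
  then show ?thesis by (simp add: E_op_def undecided_def)
qed

text \<open>A covered extreme cell leaves its neighbour as it is. A free one takes the neighbour
  along in a vertical domino, or admits no tiling if the neighbour is covered. These are the cases
  of \<open>K_op\<close> at either end.\<close>

lemma num_tilings_K:
  assumes n: "int n = k + int M + 1" and len: "length \<delta> + 2 = 2 * M"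
  shows "num_tilings dominoes (region n k (free (- int M - 1) (e1 # e2 # \<delta> @ [e3, e4]))) =
    (if (e1, e2) = (0, 1) \<or> (e3, e4) = (1, 0) then 0
     else num_tilings dominoes (region n k (free (- int M)
       ((if (e1, e2) = (1, 0) then 0 else 1) # \<delta> @ [if (e3, e4) = (0, 1) then 0 else 1]))))"
proof -
  let ?b = "- int M - 1"
  have ends: "k - int n = ?b" "k - int n + 1 = - int M" "int n - k = int M + 1"
    "int n - k - 1 = int M" "int n - k - 2 = int M - 1"
    using n by auto
  define D where "D = free (- int M + 1) \<delta>"
  have D: "D \<subseteq> {- int M + 1..<int M - 1}"
    using free_subset[of "- int M + 1" \<delta>] len by (auto simp: D_def subset_iff)
  have pos: "- int M + 1 + int (length \<delta>) = int M - 1" "?b + 1 = - int M" "int M - 1 + 1 = int M"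
    using len by linarith+
  have X: "free ?b (e1 # e2 # \<delta> @ [e3, e4]) = (if e1 = 0 then {?b} else {})
      \<union> (if e2 = 0 then {- int M} else {}) \<union> D \<union> (if e3 = 0 then {int M - 1} else {}) \<union> (if e4 = 0 then {int M} else {})"
    by (simp only: free.simps free_append pos D_def Un_empty_right Un_assoc)
  have Y: "free (- int M) (a # \<delta> @ [b]) = (if a = 0 then {- int M} else {}) \<union> D
      \<union> (if b = 0 then {int M - 1} else {})" for a b
    by (simp only: free.simps free_append pos D_def Un_empty_right Un_assoc)
  \<comment> \<open>This keeps the four end heights distinct, so the two ends can be treated one
    after the other.\<close>
  have M: "M \<ge> 1" using len by auto
  have bot: "num_tilings dominoes (region n k X) = (if - int M \<in> X
    then num_tilings dominoes (region n k (X - {?b, - int M})) else 0)"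
    if "X \<subseteq> {?b..<int M + 1}" "?b \<in> X" for X
    using num_tilings_bottom[of X k n] that finite_subset[OF that(1)] unfolding ends by simp
  have top: "num_tilings dominoes (region n k X) = (if int M - 1 \<in> X
    then num_tilings dominoes (region n k (X - {int M - 1, int M})) else 0)"
    if "X \<subseteq> {?b..<int M + 1}" "int M \<in> X" for X
    using num_tilings_top[of X k n] that finite_subset[OF that(1)] unfolding ends by simp
  have notin: "?b \<notin> D" "- int M \<notin> D" "int M - 1 \<notin> D" "int M \<notin> D" using D by auto
  have D': "D \<subseteq> {?b..<int M + 1}" using D by (auto simp: subset_iff)
  define T where "T = (if e3 = 0 then {int M - 1} else {}) \<union> (if e4 = 0 then {int M} else {})"
  have T: "T \<subseteq> {?b..<int M + 1}" "?b \<notin> T" "- int M \<notin> T" using M by (auto simp: T_def)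
  have left: "num_tilings dominoes (region n k (free ?b (e1 # e2 # \<delta> @ [e3, e4]))) =
    (if (e1, e2) = (0, 1) then 0 else num_tilings dominoes (region n k
       ((if (e1, e2) = (1, 0) then {- int M} else {}) \<union> D \<union> T)))"
  proof (cases "e1 = 0")
    case False
    then show ?thesis unfolding X by (simp add: T_def Un_assoc)
  next
    case True
    let ?Z = "insert ?b ((if e2 = 0 then {- int M} else {}) \<union> D \<union> T)"
    have Z1: "num_tilings dominoes (region n k ?Z) = (if - int M \<in> ?Z
      then num_tilings dominoes (region n k (?Z - {?b, - int M})) else 0)"
      using D' T(1) by (intro bot) auto
    have Z2: "?Z - {?b, - int M} = D \<union> T" "- int M \<in> ?Z \<longleftrightarrow> e2 = 0"
      using notin T(2,3) by auto
    have Z3: "free ?b (e1 # e2 # \<delta> @ [e3, e4]) = ?Z"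
      unfolding X T_def using True by auto
    show ?thesis by (subst Z3, subst Z1, subst Z2(1), subst Z2(2)) (use True in simp)
  qed
  \<comment> \<open>\<open>S\<close> is what the bottom end leaves of the cell at height
    \<open>- M\<close>; both outcomes are handled at once.\<close>
  have right: "num_tilings dominoes (region n k (S \<union> D \<union> T)) =
    (if (e3, e4) = (1, 0) then 0 else num_tilings dominoes (region n k
       (S \<union> D \<union> (if (e3, e4) = (0, 1) then {int M - 1} else {}))))"
    if S: "S \<subseteq> {- int M}" for S
  proof (cases "e4 = 0")
    case False
    then show ?thesis by (simp add: T_def)
  next
    case True
    have S': "S \<subseteq> {?b..<int M + 1}" "int M - 1 \<notin> S" "int M \<notin> S"
    proof -
      have "int M - 1 \<noteq> - int M" "int M \<noteq> - int M" using M by presburger+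
      then show "int M - 1 \<notin> S" "int M \<notin> S" using S by blast+
      show "S \<subseteq> {?b..<int M + 1}" using S M by auto
    qed
    have "num_tilings dominoes (region n k (S \<union> D \<union> T)) = (if int M - 1 \<in> S \<union> D \<union> T
      then num_tilings dominoes (region n k ((S \<union> D \<union> T) - {int M - 1, int M})) else 0)"
      using D' T(1) S'(1) True by (intro top) (auto simp: T_def)
    moreover have "(S \<union> D \<union> T) - {int M - 1, int M} = S \<union> D" "int M - 1 \<in> S \<union> D \<union> T \<longleftrightarrow> e3 = 0"
      using notin S'(2,3) True by (auto simp: T_def)
    ultimately show ?thesis using True by simp
  qed
  have "(if (e1, e2) = (1, 0) then {- int M} else {}) \<subseteq> {- int M}" by simp
  note right_S = right[OF this]
  show ?thesis unfolding left right_S Y by simp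
qed

section \<open>The recursion over the columns\<close>

lemma num_tilings_region_1:
  assumes "length \<epsilon> = 2" "int n = k + 1"
  shows "num_tilings dominoes (region n k (free (- 1) \<epsilon>)) = C_fun 1 \<epsilon>"
proof -
  obtain e1 e2 where \<epsilon>: "\<epsilon> = [e1, e2]"
    using assms(1) by (auto simp: numeral_2_eq_2 length_Suc_conv)
  \<comment> \<open>Column \<open>k = n - 1\<close> is the last one, so nothing lies to its
    right.\<close>
  have R: "region n k X = {k} \<times> X" for X
    using assms(2) by (auto simp: region_def)
  have zero: "num_tilings dominoes (region n k {}) = 1" by (simp add: R num_tilings_empty)
  have eq: "k - int n = -1" "int n - k = 1" using assms(2) by auto
  have C: "C_fun 1 \<epsilon> = (if e1 = e2 then 1 else 0)"
    by (subst C_fun.simps) (cases e1; cases e2; simp add: \<epsilon>)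
  show ?thesis
    unfolding C
    using num_tilings_bottom[of "free (-1) \<epsilon>" k n] num_tilings_top[of "free (-1) \<epsilon>" k n]
    by (cases e1; cases e2) (auto simp: \<epsilon> eq zero)
qed

text \<open>Induction on the number \<open>M\<close> of columns left, with \<open>k\<close> general
  because the induction hypothesis is applied to column \<open>k + 1\<close>.\<close>

theorem num_tilings_eq_C_fun:
  assumes "length \<epsilon> = 2 * M" "M \<ge> 1" "int n = k + int M"
  shows "num_tilings dominoes (region n k (free (- int M) \<epsilon>)) = C_fun M \<epsilon>"
  using assms(2,1,3)
proof (induction M arbitrary: \<epsilon> k rule: nat_induct_at_least)
  case base
  then show ?case using num_tilings_region_1 by simp
next
  case (Suc M)
  \<comment> \<open>The length is at least four, so two entries can be split off at both
    ends.\<close>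
  obtain e1 e2 \<delta>' where 1: "\<epsilon> = e1 # e2 # \<delta>'"
    using Suc.prems by (auto simp: length_Suc_conv)
  obtain \<delta>'' e4 where 2: "\<delta>' = \<delta>'' @ [e4]"
    using Suc 1 by (cases \<delta>' rule: rev_cases) auto
  obtain \<delta> e3 where 3: "\<delta>'' = \<delta> @ [e3]"
    using Suc 1 2 by (cases \<delta>'' rule: rev_cases) auto
  have \<epsilon>: "\<epsilon> = e1 # e2 # \<delta> @ [e3, e4]" using 1 2 3 by simp
  have len: "length \<delta> + 2 = 2 * M" using Suc.prems(1) \<epsilon> by simp
  \<comment> \<open>The part after \<open>K_op\<close>: complementation moves into the argument of
    \<open>C_fun M\<close>, where the induction hypothesis at \<open>k + 1\<close> counts the
    tilings of the remaining columns.\<close>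
  have "hom_extend (C_fun M) (R_op (E_op (2 * M) (frag_of \<eta>)))
      = num_tilings dominoes (region n k (free (- int M) \<eta>))" if "length \<eta> = 2 * M" for \<eta>
    unfolding hom_extend_R_op
  proof (rule hom_extend_E_op)
    fix \<delta> :: "bit list" assume "length \<delta> = 2 * M"
    then show "C_fun M (map (\<lambda>e. 1 - e) \<delta>)
      = num_tilings dominoes (region n (k + 1) (free (- int M) (map (\<lambda>e. 1 - e) \<delta>)))"
      using Suc.prems(2) by (intro Suc.IH[symmetric]) simp_all
  qed (use Suc that in simp_all)
  note RE = this
  have "length \<delta> + 4 = 2 * M + 2" using len by simp
  then have C: "C_fun (Suc M) \<epsilon>
    = hom_extend (C_fun M) (R_op (E_op (2 * M) (K_op (length \<delta> + 4) (frag_of \<epsilon>))))"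
    using C_fun_Suc[OF Suc.hyps, of \<epsilon>] by (simp only:)
  have neg: "- int (Suc M) = - int M - 1" by simp
  have K: "num_tilings dominoes (region n k (free (- int (Suc M)) \<epsilon>)) =
    (if (e1, e2) = (0, 1) \<or> (e3, e4) = (1, 0) then 0
     else num_tilings dominoes (region n k (free (- int M)
       ((if (e1, e2) = (1, 0) then 0 else 1) # \<delta> @ [if (e3, e4) = (0, 1) then 0 else 1]))))"
    unfolding \<epsilon> neg by (rule num_tilings_K) (use Suc.prems(2) len in simp_all)
  show ?case
  proof (cases "(e1, e2) = (0, 1) \<or> (e3, e4) = (1, 0)")
    case True
    then have "K_op (length \<delta> + 4) (frag_of \<epsilon>) = 0" unfolding \<epsilon> K_op_frag_of by (simp only: if_True)
    then have "C_fun (Suc M) \<epsilon> = 0" unfolding C by (simp add: E_op_def fold_E_step_0 hom_extend_R_op)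
    then show ?thesis unfolding K using True by (simp only: if_True)
  next
    case False
    then show ?thesis unfolding K C unfolding \<epsilon> K_op_frag_of
      by (simp only: if_False) (rule RE[symmetric], use len in simp)
  qed
qed

section \<open>Symmetric tilings and half tilings\<close>

text \<open>\<open>max i (- 1 - i)\<close> numbers the columns outwards from the axis, starting with
  \<open>0\<close> on both sides.\<close>

definition diamond_cells :: "nat \<Rightarrow> (int \<times> int) set" where
  "diamond_cells n = {(i, j). max i (- 1 - i) - int n \<le> j \<and> j < int n - max i (- 1 - i)}"

text \<open>The reflected unit square has its left edge at \<open>- (i + 1)\<close>.\<close>

definition flip :: "int \<times> int \<Rightarrow> int \<times> int" where
  "flip = (\<lambda>(i, j). (- 1 - i, j))"

definition right_half :: "(int \<times> int) set" where
  "right_half = {(i, j). 0 \<le> i}"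

lemma flip_flip [simp]: "flip (flip c) = c"
  by (auto simp: flip_def split: prod.splits)

lemma flip_image_flip [simp]: "flip ` flip ` d = d"
  by (simp add: image_image)

lemma inj_flip: "inj flip"
  by (metis flip_flip injI)

lemma flip_hdom: "flip ` hdom i j = hdom (- 2 - i) j"
  by (auto simp: flip_def hdom_def)

lemma flip_vdom: "flip ` vdom i j = vdom (- 1 - i) j"
  by (auto simp: flip_def vdom_def)

lemma flip_domino: "d \<in> dominoes \<Longrightarrow> flip ` d \<in> dominoes"
  by (auto simp: dominoes_def flip_hdom flip_vdom)

section \<open>Cutting at the axis and gluing\<close>

lemma domino_trichotomy:
  assumes "d \<in> dominoes"
  obtains "d \<subseteq> right_half" | "d \<inter> right_half = {}" | j where "d = hdom (- 1) j"
proof -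
  consider i j where "d = hdom i j" | i j where "d = vdom i j"
    using assms by (auto simp: dominoes_def)
  then show ?thesis
  proof cases
    case 1
    consider "i \<ge> 0" | "i < - 1" | "i = - 1" by linarith
    then show ?thesis
      by cases (use 1 that in \<open>auto simp: hdom_def right_half_def\<close>)
  next
    case 2
    then show ?thesis
      by (cases "i \<ge> 0") (use 2 that in \<open>auto simp: vdom_def right_half_def\<close>)
  qed
qed

text \<open>Meant as the inverse of cutting: the last part fills the cells missed in column
  \<open>0\<close> together with their mirror images.\<close>

definition glue :: "nat \<Rightarrow> (int \<times> int) set set \<Rightarrow> (int \<times> int) set set" where
  "glue n P = P \<union> (`) flip ` P \<union> hdom (- 1) ` {j \<in> {- int n..<int n}. (0, j) \<notin> \<Union>P}"

lemma right_half_tiling: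
  assumes P: "P \<in> tilings dominoes (diamond_cells n)"
  shows "{d \<in> P. d \<subseteq> right_half} \<in> (\<Union>X\<in>Pow {- int n..<int n}. tilings dominoes (region n 0 X))"
proof -
  \<comment> \<open>\<open>?X\<close> holds the heights at which column \<open>0\<close> is covered
    from within the right half; crossing dominoes account for the others.\<close>
  let ?Q = "{d \<in> P. d \<subseteq> right_half}" and ?X = "{j. (0, j) \<in> \<Union>{d \<in> P. d \<subseteq> right_half}}"
  have P': "P \<subseteq> dominoes" "disjoint P" "\<Union>P = diamond_cells n"
    using P by (auto simp: tilings_def)
  have Q: "c \<in> diamond_cells n" "c \<in> right_half" if "c \<in> \<Union>?Q" for c
    using that P'(3) by auto
  have X: "?X \<subseteq> {- int n..<int n}"
  proof
    fix j assume "j \<in> ?X"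
    then have "(0, j) \<in> diamond_cells n" using Q by blast
    then show "j \<in> {- int n..<int n}" by (auto simp: diamond_cells_def)
  qed
  have "c \<in> \<Union>?Q \<longleftrightarrow> c \<in> region n 0 ?X" for c
  proof (cases c)
    case (Pair i j)
    show ?thesis
    proof
      assume c: "c \<in> \<Union>?Q"
      then have "(i, j) \<in> diamond_cells n" "i \<ge> 0"
        using Q[OF c] unfolding Pair by (auto simp: right_half_def)
      then show "c \<in> region n 0 ?X"
        using c unfolding Pair by (cases "i = 0") (auto simp: mem_region diamond_cells_def)
    next
      assume "c \<in> region n 0 ?X"
      then consider "0 < i" "i - int n \<le> j" "j < int n - i" | "i = 0" "j \<in> ?X"
        unfolding Pair mem_region by blast
      then show "c \<in> \<Union>?Q"
      proof cases
        case 1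
        then have "(i, j) \<in> \<Union>P" unfolding P'(3) by (auto simp: diamond_cells_def)
        then obtain d where d: "d \<in> P" "(i, j) \<in> d" by blast
        then have "d \<in> dominoes" using P'(1) by auto
        \<comment> \<open>A crossing domino reaches only column \<open>0\<close>, whereas here
          \<open>0 < i\<close>.\<close>
        then have "d \<subseteq> right_half"
          by (rule domino_trichotomy) (use d 1 in \<open>auto simp: right_half_def hdom_def\<close>)
        then show ?thesis using d Pair by auto
      qed (use Pair in simp)
    qed
  qed
  then have "\<Union>?Q = region n 0 ?X" by blast
  moreover have "disjoint ?Q" using P'(2) by (rule pairwise_subset) auto
  moreover have "?Q \<subseteq> dominoes" using P'(1) by auto
  ultimately have "?Q \<in> tilings dominoes (region n 0 ?X)"
    unfolding tilings_def by (intro CollectI conjI)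
  then show ?thesis using X by blast
qed

text \<open>The right part, its mirror image and the crossing dominoes cover disjoint regions that
  make up the diamond.\<close>

lemma glue_tiling:
  assumes P: "P \<in> tilings dominoes (region n 0 X)" and X: "X \<subseteq> {- int n..<int n}"
  shows "glue n P \<in> tilings dominoes (diamond_cells n)" "(`) flip ` glue n P = glue n P"
proof -
  let ?F = "hdom (- 1) ` ({- int n..<int n} - X)"
  have P': "P \<subseteq> dominoes" "disjoint P" "\<Union>P = region n 0 X"
    using P by (auto simp: tilings_def)
  have glue: "glue n P = P \<union> (`) flip ` P \<union> ?F"
    unfolding glue_def P'(3) by (auto simp: mem_region)
  define L where "L = flip ` region n 0 X"
  have U: "\<Union>?F = {- 1, 0} \<times> ({- int n..<int n} - X)" "\<Union>((`) flip ` P) = L"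
    unfolding L_def P'(3)[symmetric] by (auto simp: hdom_def)
  have L: "(i, j) \<in> L \<longleftrightarrow> (- 1 - i, j) \<in> region n 0 X" for i j
    by (force simp: L_def flip_def image_iff)
  have disj: "disjoint ((`) flip ` P)" "disjoint ?F"
    using disjoint_image[OF inj_on_subset[OF inj_flip subset_UNIV] P'(2)]
    by (auto simp: pairwise_def disjnt_def hdom_def)
  have "disjoint (glue n P)" unfolding glue
    by (intro disjoint_union P'(2) disj)
      (auto simp: U P'(3) Union_Un_distrib L mem_region)
  moreover have "\<Union>(glue n P) = diamond_cells n"
  proof -
    have "\<Union>(glue n P) = region n 0 X \<union> L \<union> {- 1, 0} \<times> ({- int n..<int n} - X)"
      unfolding glue Union_Un_distrib U P'(3) ..
    moreover have "c \<in> \<dots> \<longleftrightarrow> c \<in> diamond_cells n" for c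
    proof (cases c)
      case (Pair i j)
      consider "i > 0" | "i = 0" | "i = - 1" | "i < - 1" by linarith
      then show ?thesis
        unfolding Pair using X by cases (auto simp: L mem_region diamond_cells_def)
    qed
    ultimately show ?thesis by blast
  qed
  moreover have "glue n P \<subseteq> dominoes" using P'(1) flip_domino unfolding glue by auto
  ultimately show "glue n P \<in> tilings dominoes (diamond_cells n)" by (simp add: tilings_def)
  \<comment> \<open>Flipping exchanges the first two parts and fixes each crossing domino, because
    \<open>- 2 - (- 1) = - 1\<close>.\<close>
  show "(`) flip ` glue n P = glue n P"
    unfolding glue by (simp add: image_Un image_image flip_hdom Un_ac)
qed

text \<open>Invariance recovers the left dominoes as mirror images; the crossing ones sit exactly
  where column \<open>0\<close> is not covered from the right.\<close>

lemma glue_right_half: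
  assumes P: "P \<in> tilings dominoes (diamond_cells n)" and sym: "(`) flip ` P = P"
  shows "glue n {d \<in> P. d \<subseteq> right_half} = P"
proof -
  let ?Q = "{d \<in> P. d \<subseteq> right_half}"
  have P': "P \<subseteq> dominoes" "disjoint P" "\<Union>P = diamond_cells n"
    using P by (auto simp: tilings_def)
  have flipP: "flip ` d \<in> P" if "d \<in> P" for d using that sym by blast
  have crossing: "hdom (- 1) j \<in> P \<longleftrightarrow> j \<in> {- int n..<int n} \<and> (0, j) \<notin> \<Union>?Q" for j
  proof
    assume d: "hdom (- 1) j \<in> P"
    then have "(0, j) \<in> diamond_cells n" using P'(3) by (auto simp: hdom_def)
    moreover have "(0, j) \<notin> e" if "e \<in> ?Q" for e
    proof
      assume "(0, j) \<in> e"
      moreover have "(0, j) \<in> hdom (- 1) j" by (simp add: hdom_def)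
      ultimately have "e = hdom (- 1) j" using disjointD[OF P'(2), of e "hdom (- 1) j"] d that by auto
      then show False using that by (auto simp: hdom_def right_half_def)
    qed
    ultimately show "j \<in> {- int n..<int n} \<and> (0, j) \<notin> \<Union>?Q" by (auto simp: diamond_cells_def)
  next
    assume j: "j \<in> {- int n..<int n} \<and> (0, j) \<notin> \<Union>?Q"
    then have "(0, j) \<in> \<Union>P" unfolding P'(3) by (auto simp: diamond_cells_def)
    then obtain d where d: "d \<in> P" "(0, j) \<in> d" by blast
    then have "d \<in> dominoes" using P'(1) by auto
    then show "hdom (- 1) j \<in> P"
      by (rule domino_trichotomy) (use d j in \<open>auto simp: right_half_def hdom_def\<close>)
  qed
  show ?thesis
  proof (intro equalityI subsetI)
    fix d assume "d \<in> glue n ?Q"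
    then show "d \<in> P" unfolding glue_def using crossing flipP by blast
  next
    fix d assume d: "d \<in> P"
    then have "d \<in> dominoes" using P'(1) by auto
    then show "d \<in> glue n ?Q"
    proof (rule domino_trichotomy)
      assume "d \<inter> right_half = {}"
      then have "flip ` d \<subseteq> right_half" by (auto simp: right_half_def flip_def)
      then have "flip ` d \<in> ?Q" using flipP[OF d] by simp
      then have "flip ` flip ` d \<in> (`) flip ` ?Q" by (rule imageI)
      then show ?thesis by (simp add: glue_def)
    next
      fix j assume "d = hdom (- 1) j"
      then show ?thesis using crossing[of j] d by (simp add: glue_def)
    qed (use d in \<open>simp add: glue_def\<close>)
  qed
qed

text \<open>Each added domino has a cell in a negative column; for the mirror images this uses that
  blocks of \<open>P\<close> are nonempty.\<close>

lemma right_half_glue: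
  assumes P: "P \<in> tilings dominoes (region n 0 X)"
  shows "{d \<in> glue n P. d \<subseteq> right_half} = P"
proof -
  have P': "P \<subseteq> dominoes" "\<Union>P = region n 0 X" using P by (auto simp: tilings_def)
  have sub: "d \<subseteq> right_half" "d \<noteq> {}" if "d \<in> P" for d
  proof -
    have "region n 0 X \<subseteq> right_half" by (auto simp: mem_region right_half_def)
    then show "d \<subseteq> right_half" using that P'(2) by blast
    show "d \<noteq> {}" using that P'(1) by auto
  qed
  have "\<not> flip ` d \<subseteq> right_half" if d: "d \<in> P" for d
  proof -
    obtain i j where "(i, j) \<in> d" "i \<ge> 0"
      using sub[OF d] by (fastforce simp: right_half_def)
    then have "(- 1 - i, j) \<in> flip ` d" "(- 1 - i, j) \<notin> right_half"
      by (force simp: flip_def right_half_def)+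
    then show ?thesis by blast
  qed
  moreover have "\<not> hdom (- 1) j \<subseteq> right_half" for j by (auto simp: hdom_def right_half_def)
  ultimately have "d \<in> P" if "d \<in> glue n P" "d \<subseteq> right_half" for d
    using that unfolding glue_def by (elim UnE imageE) auto
  moreover have "P \<subseteq> glue n P" by (auto simp: glue_def)
  ultimately show ?thesis using sub(1) by auto
qed

text \<open>Cutting and gluing are inverse bijections; the half tilings are then sorted by the set
  \<open>X\<close> of cells that they cover in column \<open>0\<close>.\<close>

lemma card_symmetric_tilings:
  assumes "n \<ge> 1"
  shows "int (card {P \<in> tilings dominoes (diamond_cells n). (`) flip ` P = P})
    = (\<Sum>\<epsilon>\<in>binseq (2 * n). C_fun n \<epsilon>)"
proof -
  let ?H = "\<lambda>X. tilings dominoes (region n 0 X)"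
  let ?I = "Pow {- int n..<int n}"
  have "bij_betw (\<lambda>P. {d \<in> P. d \<subseteq> right_half})
    {P \<in> tilings dominoes (diamond_cells n). (`) flip ` P = P} (\<Union>X\<in>?I. ?H X)"
  proof (rule bij_betw_byWitness[where f' = "glue n"])
    show "glue n ` (\<Union>X\<in>?I. ?H X) \<subseteq> {P \<in> tilings dominoes (diamond_cells n). (`) flip ` P = P}"
      using glue_tiling by blast
    show "(\<lambda>P. {d \<in> P. d \<subseteq> right_half}) ` {P \<in> tilings dominoes (diamond_cells n). (`) flip ` P = P}
        \<subseteq> (\<Union>X\<in>?I. ?H X)"
      by (intro image_subsetI right_half_tiling) simp
    show "\<forall>P\<in>\<Union>X\<in>?I. ?H X. {d \<in> glue n P. d \<subseteq> right_half} = P"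
      by (intro ballI) (elim UN_E, rule right_half_glue)
  qed (simp add: glue_right_half)
  then have "card {P \<in> tilings dominoes (diamond_cells n). (`) flip ` P = P} = card (\<Union>X\<in>?I. ?H X)"
    by (rule bij_betw_same_card)
  also have "\<dots> = (\<Sum>X\<in>?I. card (?H X))"
  proof (rule card_UN_disjoint)
    show "\<forall>X\<in>?I. finite (?H X)"
      by (intro ballI finite_tilings finite_region) (auto intro: finite_subset)
    show "\<forall>X\<in>?I. \<forall>Y\<in>?I. X \<noteq> Y \<longrightarrow> ?H X \<inter> ?H Y = {}"
    proof (intro ballI impI)
      fix X Y :: "int set" assume "X \<noteq> Y"
      \<comment> \<open>A tiling determines its region as the union of its blocks, and the region
        determines \<open>X\<close>.\<close>
      then have "region n 0 X \<noteq> region n 0 Y" by (auto simp: set_eq_iff mem_region)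
      then show "?H X \<inter> ?H Y = {}" by (auto simp: tilings_def)
    qed
  qed simp
  also have "\<dots> = (\<Sum>\<epsilon>\<in>binseq (2 * n). card (?H (free (- int n) \<epsilon>)))"
    using bij_betw_free[of "- int n" "2 * n"]
    by (intro sum.reindex_bij_betw[symmetric]) simp
  finally have "int (card {P \<in> tilings dominoes (diamond_cells n). (`) flip ` P = P})
      = (\<Sum>\<epsilon>\<in>binseq (2 * n). num_tilings dominoes (region n 0 (free (- int n) \<epsilon>)))"
    by (simp add: num_tilings_def)
  also have "\<dots> = (\<Sum>\<epsilon>\<in>binseq (2 * n). C_fun n \<epsilon>)"
    using assms by (intro sum.cong num_tilings_eq_C_fun) (auto simp: binseq_def)
  finally show ?thesis .
qed

section \<open>From point sets to cells\<close>

definition squares :: "(int \<times> int) set \<Rightarrow> (real \<times> real) set" where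
  "squares A = (\<Union>(i, j)\<in>A. unit_square i j)"

text \<open>Closed squares share edges; a point without integer coordinates lies on no edge and so
  determines its square.\<close>

lemma mem_unit_square_iff:
  assumes "x \<notin> \<int>" "y \<notin> \<int>"
  shows "(x, y) \<in> unit_square i j \<longleftrightarrow> i = \<lfloor>x\<rfloor> \<and> j = \<lfloor>y\<rfloor>"
proof -
  have *: "z \<in> {of_int i..of_int i + 1} \<longleftrightarrow> i = \<lfloor>z\<rfloor>" if "z \<notin> \<int>" for z :: real and i
  proof
    assume z: "z \<in> {of_int i..of_int i + 1}"
    have "of_int i + 1 = (of_int (i + 1) :: real)" by simp
    then have "z \<noteq> of_int i + 1" using that Ints_of_int by metis
    then show "i = \<lfloor>z\<rfloor>" using z by (auto intro!: floor_unique[symmetric])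
  next
    assume "i = \<lfloor>z\<rfloor>"
    then show "z \<in> {of_int i..of_int i + 1}"
      by (simp add: of_int_floor_le real_of_int_floor_add_one_ge)
  qed
  show ?thesis using *[OF assms(1), of i] *[OF assms(2), of j] by (simp add: unit_square_def)
qed

lemma mem_squares_iff:
  assumes "x \<notin> \<int>" "y \<notin> \<int>"
  shows "(x, y) \<in> squares A \<longleftrightarrow> (\<lfloor>x\<rfloor>, \<lfloor>y\<rfloor>) \<in> A"
  using assms by (force simp: squares_def mem_unit_square_iff)

lemma half_notin_Ints: "real_of_int i + 1 / 2 \<notin> \<int>"
proof
  assume "real_of_int i + 1 / 2 \<in> \<int>"
  then have "of_int \<lfloor>real_of_int i + 1 / 2\<rfloor> = real_of_int i + 1 / 2" by (simp add: of_int_floor)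
  moreover have "\<lfloor>real_of_int i + 1 / 2\<rfloor> = i" by (rule floor_unique) auto
  ultimately show False by simp
qed

text \<open>Centres recover the cells from the point set, which makes \<open>squares\<close>
  injective.\<close>

lemma center_mem_squares:
  "(of_int i + 1 / 2, of_int j + 1 / 2) \<in> squares A \<longleftrightarrow> (i, j) \<in> A"
proof -
  have "\<lfloor>real_of_int k + 1 / 2\<rfloor> = k" for k by (rule floor_unique) auto
  then show ?thesis using mem_squares_iff[OF half_notin_Ints half_notin_Ints] by simp
qed

lemma inj_squares: "inj squares"
proof (rule injI)
  fix A B assume "squares A = squares B"
  then have "(i, j) \<in> A \<longleftrightarrow> (i, j) \<in> B" for i j using center_mem_squares by metis
  then show "A = B" by auto
qed

lemma squares_Union: "squares (\<Union>P) = \<Union>(squares ` P)"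
  by (auto simp: squares_def)

text \<open>A common cell has its centre in both interiors. Conversely, near a common interior point
  there is one without integer coordinates, and its cell is common.\<close>

lemma interior_squares_disjoint_iff:
  "interior (squares A) \<inter> interior (squares B) = {} \<longleftrightarrow> A \<inter> B = {}"
proof
  assume int: "interior (squares A) \<inter> interior (squares B) = {}"
  have "(of_int i + 1 / 2, of_int j + 1 / 2) \<in> interior (squares C)" if "(i, j) \<in> C" for i j C
  proof (rule interiorI)
    show "open ({real_of_int i<..<of_int i + 1} \<times> {real_of_int j<..<of_int j + 1})"
      by (intro open_Times) auto
    show "{real_of_int i<..<of_int i + 1} \<times> {real_of_int j<..<of_int j + 1} \<subseteq> squares C"
      using that by (force simp: squares_def unit_square_def)
  qed auto
  then have "(i, j) \<notin> A \<or> (i, j) \<notin> B" for i j using int by (meson disjoint_iff)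
  then show "A \<inter> B = {}" by auto
next
  assume AB: "A \<inter> B = {}"
  show "interior (squares A) \<inter> interior (squares B) = {}"
  proof (rule ccontr)
    assume "interior (squares A) \<inter> interior (squares B) \<noteq> {}"
    then obtain p where p: "p \<in> interior (squares A) \<inter> interior (squares B)" by blast
    have "open (interior (squares A) \<inter> interior (squares B))" by auto
    then obtain U V where UV: "open U" "open V" "p \<in> U \<times> V"
        "U \<times> V \<subseteq> interior (squares A) \<inter> interior (squares B)"
      using p by (rule open_prod_elim)
    \<comment> \<open>Countability of the integers yields non-integers in the nonempty open sets
      \<open>U\<close> and \<open>V\<close>.\<close>
    have count: "countable (\<int> :: real set)" unfolding Ints_def by simp
    obtain x where x: "x \<in> U" "x \<notin> \<int>" using open_minus_countable[OF count, of U] UV by auto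
    obtain y where y: "y \<in> V" "y \<notin> \<int>" using open_minus_countable[OF count, of V] UV by auto
    have "(x, y) \<in> squares A" "(x, y) \<in> squares B"
      using x y UV(4) interior_subset by blast+
    then show False using AB x y by (auto simp: mem_squares_iff)
  qed
qed

lemma unit_square_subset_diamond_iff:
  "unit_square i j \<subseteq> {(x, y). \<bar>x\<bar> + \<bar>y\<bar> \<le> real n + 1} \<longleftrightarrow> (i, j) \<in> diamond_cells n"
proof
  assume sub: "unit_square i j \<subseteq> {(x, y). \<bar>x\<bar> + \<bar>y\<bar> \<le> real n + 1}"
  have "\<bar>a\<bar> + \<bar>b\<bar> \<le> int n + 1" if "a \<in> {i, i + 1}" "b \<in> {j, j + 1}" for a b
  proof -
    have "(real_of_int a, real_of_int b) \<in> unit_square i j"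
      using that by (auto simp: unit_square_def)
    then have "real_of_int (\<bar>a\<bar> + \<bar>b\<bar>) \<le> real_of_int (int n + 1)" using sub by auto
    then show ?thesis by (simp only: of_int_le_iff)
  qed
  \<comment> \<open>The four corners of the square suffice for this direction.\<close>
  from this[of i j] this[of i "j + 1"] this[of "i + 1" j] this[of "i + 1" "j + 1"]
  have "\<bar>i\<bar> + \<bar>j\<bar> \<le> int n + 1" "\<bar>i\<bar> + \<bar>j + 1\<bar> \<le> int n + 1" "\<bar>i + 1\<bar> + \<bar>j\<bar> \<le> int n + 1"
    "\<bar>i + 1\<bar> + \<bar>j + 1\<bar> \<le> int n + 1" by simp_all
  then have "max i (- 1 - i) - int n \<le> j" "j < int n - max i (- 1 - i)" by linarith+
  then show "(i, j) \<in> diamond_cells n" by (simp add: diamond_cells_def)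
next
  assume "(i, j) \<in> diamond_cells n"
  \<comment> \<open>With \<open>a = max i (- 1 - i)\<close>, the square satisfies
    \<open>\<bar>x\<bar> \<le> a + 1\<close> and \<open>\<bar>y\<bar> \<le> n - a\<close>.\<close>
  then obtain a where a: "i \<le> a" "- 1 - i \<le> a" "a - int n \<le> j" "j + 1 \<le> int n - a"
    by (auto simp: diamond_cells_def intro: that[of "max i (- 1 - i)"])
  have "real_of_int i \<le> of_int a" "real_of_int (- 1 - i) \<le> of_int a"
    "real_of_int (a - int n) \<le> of_int j" "real_of_int (j + 1) \<le> of_int (int n - a)"
    using a by (simp_all only: of_int_le_iff)
  then show "unit_square i j \<subseteq> {(x, y). \<bar>x\<bar> + \<bar>y\<bar> \<le> real n + 1}"
    by (auto simp: unit_square_def)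
qed

section \<open>Tilings and reflection translated from point sets to cells\<close>

lemma aztec_diamond_eq_squares: "aztec_diamond n = squares (diamond_cells n)"
  unfolding aztec_diamond_def unit_square_subset_diamond_iff squares_def by auto

lemma domino_iff: "domino D \<longleftrightarrow> D \<in> squares ` dominoes"
proof -
  have "squares (hdom i j) = unit_square i j \<union> unit_square (i + 1) j"
    "squares (vdom i j) = unit_square i j \<union> unit_square i (j + 1)" for i j
    by (simp_all add: squares_def hdom_def vdom_def)
  moreover have "D \<in> squares ` dominoes
      \<longleftrightarrow> (\<exists>i j. D = squares (hdom i j) \<or> D = squares (vdom i j))"
    by (auto simp: dominoes_def)
  ultimately show ?thesis by (simp add: domino_def)
qed

text \<open>Injectivity of \<open>squares\<close> carries over unions and distinctness, and disjoint
  interiors become disjoint sets of cells.\<close>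

lemma domino_tiling_squares_iff:
  "domino_tiling T (squares R) \<longleftrightarrow> T \<in> (`) squares ` tilings dominoes R"
proof -
  have tiling: "domino_tiling (squares ` P) (squares R) \<longleftrightarrow> P \<in> tilings dominoes R"
    if "P \<subseteq> dominoes" for P
  proof -
    have disj: "(\<forall>D\<in>squares ` P. \<forall>D'\<in>squares ` P. D \<noteq> D' \<longrightarrow> interior D \<inter> interior D' = {})
        \<longleftrightarrow> disjoint P"
      by (simp add: interior_squares_disjoint_iff inj_eq[OF inj_squares] pairwise_def disjnt_def)
    have Un: "\<Union>(squares ` P) = squares R \<longleftrightarrow> \<Union>P = R"
      by (simp add: squares_Union[symmetric] inj_eq[OF inj_squares])
    have "\<forall>D\<in>squares ` P. domino D" using that by (auto simp: domino_iff)
    then show ?thesis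
      unfolding domino_tiling_def tilings_def mem_Collect_eq disj Un using that by iprover
  qed
  show ?thesis
  proof
    assume T: "domino_tiling T (squares R)"
    then have "T \<subseteq> squares ` dominoes" by (auto simp: domino_tiling_def domino_iff)
    then obtain P where "P \<subseteq> dominoes" "T = squares ` P" by (auto simp: subset_image_iff)
    then show "T \<in> (`) squares ` tilings dominoes R" using T tiling by blast
  next
    assume "T \<in> (`) squares ` tilings dominoes R"
    then obtain P where P: "T = squares ` P" "P \<in> tilings dominoes R" by blast
    then have "P \<subseteq> dominoes" by (simp add: tilings_def)
    then show "domino_tiling T (squares R)" using P tiling by simp
  qed
qed

lemma t_refl_unit_square: "t_refl ` unit_square i j = unit_square (- 1 - i) j"
proof -
  have "t_refl ` S = {(x, y). (- x, y) \<in> S}" for S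
    by (force simp: t_refl_def image_iff)
  then show ?thesis by (auto simp: unit_square_def)
qed

lemma t_refl_squares: "t_refl ` squares A = squares (flip ` A)"
  by (simp add: squares_def image_UN t_refl_unit_square flip_def case_prod_beta)

lemma t_invariant_squares_iff: "t_invariant (squares ` P) \<longleftrightarrow> (`) flip ` P = P"
proof -
  have "(\<lambda>D. t_refl ` D) ` squares ` P = squares ` (`) flip ` P"
    by (simp add: image_image t_refl_squares)
  then show ?thesis by (simp add: t_invariant_def inj_image_eq_iff[OF inj_squares])
qed

theorem theorem2:
  fixes n :: nat
  assumes "n \<ge> 1"
  shows "int (card {T. domino_tiling T (aztec_diamond n) \<and> t_invariant T}) = l1_norm (2 * n) (C_fun n)
    \<and> l1_norm (2 * n) (C_fun n) = (\<Sum>\<epsilon>\<in>binseq (2 * n). C_fun n \<epsilon>)"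
proof -
  \<comment> \<open>\<open>C_fun n\<close> counts tilings of the right half, the case
    \<open>k = 0\<close>, so the absolute values in the norm drop.\<close>
  have "C_fun n \<epsilon> \<ge> 0" if "\<epsilon> \<in> binseq (2 * n)" for \<epsilon>
  proof -
    have "length \<epsilon> = 2 * n" using that by (simp add: binseq_def)
    then show ?thesis
      using num_tilings_eq_C_fun[of \<epsilon> n n 0, symmetric] assms by (simp add: num_tilings_def)
  qed
  then have norm: "l1_norm (2 * n) (C_fun n) = (\<Sum>\<epsilon>\<in>binseq (2 * n). C_fun n \<epsilon>)"
    unfolding l1_norm_def by (intro sum.cong) auto
  have "{T. domino_tiling T (aztec_diamond n) \<and> t_invariant T}
    = (`) squares ` {P \<in> tilings dominoes (diamond_cells n). (`) flip ` P = P}"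
    by (auto simp: aztec_diamond_eq_squares domino_tiling_squares_iff t_invariant_squares_iff)
  moreover have "inj ((`) squares)" using inj_squares by (simp add: inj_image_eq_iff inj_def)
  ultimately have "card {T. domino_tiling T (aztec_diamond n) \<and> t_invariant T}
    = card {P \<in> tilings dominoes (diamond_cells n). (`) flip ` P = P}"
    by (simp add: card_image inj_on_subset)
  then show ?thesis using norm card_symmetric_tilings[OF assms] by simp
qed

end
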